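(* Let $f\in\mathcal{S}$ be given by $f(z)=z+a_2z^2+a_3z^3+\cdots$ in $\mathbb{D}$, and let $H_2(3)(f)=a_3a_5-a_4^2$. Then: (a) $|H_2(3)(f)|\le 2.02757\ldots$ if $a_2=0$; (b) $|H_2(3)(f)|\le 4.8986977\ldots$ for every $f\in\mathcal{S}$.
   Context: $\mathbb{D}=\{z\in\mathbb{C}:|z|<1\}$. $\mathcal{A}$ is the class of functions $f$ analytic in $\mathbb{D}$ and normalized by $f(0)=0$, $f'(0)=1$, i.e. $f(z)=z+a_2z^2+a_3z^3+\cdots$. $\mathcal{S}$ is the class of functions in $\mathcal{A}$ that are univalent (injective) in $\mathbb{D}$. For a function $f\in\mathcal{A}$ the second order Hankel determinant is $H_2(n)(f)=a_na_{n+2}-a_{n+1}^2$. A decimal followed by dots denotes a real constant whose decimal expansion begins with the displayed digits: $2.02757\ldots$ is a constant $C_1$ with $2.02757\le C_1<2.02758$, and $4.8986977\ldots$ is a constant $C_2$ with $4.8986977\le C_2<4.8986978$. *)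

theory Defs
  imports "HOL-Complex_Analysis.Complex_Analysis"
begin

text \<open>
  Only the values of \<open>f\<close> on the open unit disc \<open>ball 0 1\<close> matter below.
\<close>

definition class_A :: "(complex \<Rightarrow> complex) set" where
  "class_A = {f. f holomorphic_on ball 0 1 \<and> f 0 = 0 \<and> deriv f 0 = 1}"

definition class_S :: "(complex \<Rightarrow> complex) set" where
  "class_S = {f \<in> class_A. inj_on f (ball 0 1)}"

definition taylor_coeff :: "(complex \<Rightarrow> complex) \<Rightarrow> nat \<Rightarrow> complex" where
  "taylor_coeff f n = fps_nth (fps_expansion f 0) n"

definition hankel2 :: "nat \<Rightarrow> (complex \<Rightarrow> complex) \<Rightarrow> complex" where
  "hankel2 n f = taylor_coeff f n * taylor_coeff f (n + 2) - (taylor_coeff f (n + 1))\<^sup>2"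

end

theory Submission
  imports Defs
begin

text \<open>
  Let \<open>f\<close> be univalent with \<open>f 0 = 0\<close> and \<open>f' 0 = 1\<close>.  Its cube-root transform, the cube root of \<open>f (z ^ 3)\<close>, is
  again univalent (\<open>root_transform\<close>), and its reciprocal has the form
  \<open>p (z ^ 3) / z = 1 / z + a z\<^sup>2 + b z\<^sup>5 + c z\<^sup>8 + d z\<^sup>1\<^sup>1 + \<dots>\<close> with \<open>p = (f z / z) powr (-1/3)\<close>.  The area
  theorem (\<open>area_theorem\<close>) therefore gives \<open>2\<bar>a\<bar>\<^sup>2 + 5\<bar>b\<bar>\<^sup>2 + 8\<bar>c\<bar>\<^sup>2 + 11\<bar>d\<bar>\<^sup>2 \<le> 1\<close>.  From \<open>p ^ 3 * f = z\<close> the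
  coefficients of \<open>f\<close>, and hence the Hankel determinant, are polynomials in \<open>a, b, c, d\<close>
  (\<open>coeffs_X_over_cube\<close>, \<open>hankel_in_root_coeffs\<close>).  The triangle inequality and the area inequality bound this
  polynomial by at most \<open>4.89\<close> in general, and by \<open>2.02\<close> if \<open>a = 0\<close>, which is the case of a vanishing second
  coefficient of \<open>f\<close>.

  Every \<open>n\<close>-th root transform with \<open>n \<ge> 2\<close> yields an inequality of this kind, and square roots would give
  smaller bounds.  Cube roots make the area theorem easier.  The complement of the image of \<open>\<bar>z\<bar> < \<rho>\<close> under
  \<open>g z = p (z ^ 3) / z\<close> must be compared with a region of known area.  Without a linear term in \<open>g\<close> this region
  is nearly a round disc of radius \<open>1 / \<rho>\<close>, with an error in the area that tends to \<open>0\<close> with \<open>\<rho>\<close>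
  (\<open>holomorphic_cubic_tangency\<close>), while a linear term would turn it into an ellipse.  Univalence keeps the image
  of the annulus \<open>\<rho> < \<bar>z\<bar> < r\<close> inside that disc (\<open>injective_quotient_confined\<close>), and the area of this image is
  bounded below by Bessel's inequality on circles (\<open>gutzmer_inequality\<close>, \<open>area_annulus\<close>).  Comparing the two
  areas and letting \<open>\<rho>\<close> tend to \<open>0\<close> and \<open>r\<close> to \<open>1\<close> gives the area theorem.
\<close>

(* The infix is reserved for vector components. *)
no_notation fps_nth (infixl "$" 75)

section \<open>Means of holomorphic functions on circles\<close>

lemma mean_value_circle:
  assumes "f holomorphic_on cball 0 R" and "0 < R"
  shows "((\<lambda>t. f (complex_of_real R * cis t)) has_integral 2 * complex_of_real pi * f 0) {0..2 * pi}"
proof -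
  have "((\<lambda>u. f u / (u - 0)) has_contour_integral (2 * of_real pi * \<i> * f 0)) (circlepath 0 R)"
    by (rule Cauchy_integral_circlepath_simple) (use assms in auto)
  hence "((\<lambda>t. f (0 + of_real R * cis t) / (0 + of_real R * cis t - 0) * of_real R * \<i> * cis t)
           has_integral (2 * of_real pi * \<i> * f 0)) {0..2 * pi}"
    unfolding circlepath_def by (subst (asm) has_contour_integral_part_circlepath_iff) auto
  hence "((\<lambda>t. f (of_real R * cis t) * \<i>) has_integral (2 * of_real pi * f 0 * \<i>)) {0..2 * pi}"
    using \<open>0 < R\<close> by (simp add: field_simps)
  from has_integral_mult_left[OF this, of "-\<i>"] show ?thesis
    by (simp add: algebra_simps)
qed

text \<open>
  Splitting off the constant term and dividing by \<open>z\<close> shifts the Taylor coefficients.  This is the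
  induction step both for Bessel's inequality on circles and for reading off orders of contact at \<open>0\<close>.
  The first identity is written as a difference because \<open>f 0\<close> on the right would make it loop as a
  rewrite rule.
\<close>

lemma fps_expansion_quotient:
  assumes "f holomorphic_on ball 0 r" and "0 < r"
  obtains g where "g holomorphic_on ball 0 r" and "\<And>z. f z - f 0 = z * g z" and "g 0 = deriv f 0"
    and "\<And>n. fps_nth (fps_expansion f 0) (Suc n) = fps_nth (fps_expansion g 0) n"
proof -
  define g where "g = (\<lambda>z. if z = 0 then deriv f 0 else (f z - f 0) / (z - 0))"
  have g: "g holomorphic_on ball 0 r"
    unfolding g_def by (rule pole_lemma_open) (use assms in auto)
  have eq: "f z - f 0 = z * g z" for z by (simp add: g_def)
  have "g has_fps_expansion fps_expansion g 0"
    by (rule has_fps_expansion_fps_expansion[OF _ _ g]) (use assms in auto)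
  hence "(\<lambda>z. f 0 + z * g z) has_fps_expansion fps_const (f 0) + fps_X * fps_expansion g 0"
    by (intro fps_expansion_intros)
  hence "fps_expansion f 0 = fps_const (f 0) + fps_X * fps_expansion g 0"
    by (simp add: eq[symmetric] fps_expansion_eqI)
  hence "fps_nth (fps_expansion f 0) (Suc n) = fps_nth (fps_expansion g 0) n" for n
    by simp
  moreover have "g 0 = deriv f 0" by (simp add: g_def)
  ultimately show ?thesis using that[OF g eq] by blast
qed

lemma continuous_on_circle:
  assumes "f holomorphic_on ball 0 r" and "0 < R" and "R < r"
  shows "continuous_on T (\<lambda>t. (norm (f (complex_of_real R * cis t)))\<^sup>2)"
  using assms
  by (intro continuous_intros continuous_on_compose2[OF holomorphic_on_imp_continuous_on[OF assms(1)]])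
     (auto simp: norm_mult)

text \<open>
  On the circle \<open>\<bar>z\<bar> = R\<close> write \<open>f z = f 0 + z * g z\<close>.  The cross term \<open>2 * Re (cnj (f 0) * (z * g z))\<close> of
  \<open>\<bar>f z\<bar>\<^sup>2\<close> is harmonic and vanishes at \<open>0\<close>, so its mean is \<open>0\<close>, and the mean of \<open>\<bar>f\<bar>\<^sup>2\<close> is \<open>\<bar>f 0\<bar>\<^sup>2\<close> plus
  \<open>R\<^sup>2\<close> times the mean of \<open>\<bar>g\<bar>\<^sup>2\<close>; iterate.
\<close>

lemma gutzmer_inequality:
  assumes "f holomorphic_on ball 0 r" and "0 < R" and "R < r"
  shows "2 * pi * (\<Sum>j<N. (norm (fps_nth (fps_expansion f 0) j))\<^sup>2 * R ^ (2 * j))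
           \<le> integral {0..2 * pi} (\<lambda>t. (norm (f (complex_of_real R * cis t)))\<^sup>2)"
  using assms(1)
proof (induction N arbitrary: f)
  case 0
  have "(\<lambda>t. (norm (f (complex_of_real R * cis t)))\<^sup>2) integrable_on {0..2 * pi}"
    by (intro integrable_continuous_interval continuous_on_circle[OF 0 assms(2,3)])
  thus ?case by (simp add: integral_nonneg)
next
  case (Suc N)
  have r: "0 < r" using assms by simp
  obtain g where g: "g holomorphic_on ball 0 r" "\<And>z. f z - f 0 = z * g z" "g 0 = deriv f 0"
    "\<And>n. fps_nth (fps_expansion f 0) (Suc n) = fps_nth (fps_expansion g 0) n"
    using fps_expansion_quotient[OF Suc.prems r] by blast
  have f0: "fps_nth (fps_expansion f 0) 0 = f 0" by (simp add: fps_expansion_def)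
  define z where "z t = complex_of_real R * cis t" for t
  have nz: "norm (z t) = R" for t using assms by (simp add: z_def norm_mult)
  have split: "(norm (f (z t)))\<^sup>2 = (norm (f 0))\<^sup>2 + 2 * Re (cnj (f 0) * (z t * g (z t))) + R\<^sup>2 * (norm (g (z t)))\<^sup>2" for t
  proof -
    have "(norm (a + b))\<^sup>2 = (norm a)\<^sup>2 + 2 * Re (cnj a * b) + (norm b)\<^sup>2" for a b :: complex
      unfolding cmod_power2 by (simp add: power2_eq_square algebra_simps)
    from this[of "f 0" "z t * g (z t)"] have "(norm (f 0 + z t * g (z t)))\<^sup>2 =
       (norm (f 0))\<^sup>2 + 2 * Re (cnj (f 0) * (z t * g (z t))) + R\<^sup>2 * (norm (g (z t)))\<^sup>2"
      by (simp only: norm_mult nz power_mult_distrib)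
    thus ?thesis using g(2)[of "z t"] by (metis diff_add_cancel add.commute)
  qed
  have "((\<lambda>t. (\<lambda>w. cnj (f 0) * (w * g w)) (of_real R * cis t)) has_integral
          2 * of_real pi * (cnj (f 0) * (0 * g 0))) {0..2 * pi}"
  proof (rule mean_value_circle)
    have "g holomorphic_on cball 0 R"
      using assms by (intro holomorphic_on_subset[OF g(1)]) auto
    thus "(\<lambda>w. cnj (f 0) * (w * g w)) holomorphic_on cball 0 R"
      by (intro holomorphic_intros)
  qed fact
  from has_integral_Re[OF this]
  have cross: "((\<lambda>t. Re (cnj (f 0) * (z t * g (z t)))) has_integral 0) {0..2 * pi}"
    by (simp add: z_def)
  let ?I = "integral {0..2 * pi} (\<lambda>t. (norm (g (z t)))\<^sup>2)"
  have I: "((\<lambda>t. (norm (g (z t)))\<^sup>2) has_integral ?I) {0..2 * pi}"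
    unfolding z_def
    by (intro integrable_integral integrable_continuous_interval continuous_on_circle[OF g(1) assms(2,3)])
  have const: "((\<lambda>t. (norm (f 0))\<^sup>2) has_integral (norm (f 0))\<^sup>2 * (2 * pi)) {0..2 * pi}"
    using has_integral_const_real[of "(norm (f 0))\<^sup>2" 0 "2 * pi"] by (simp add: mult_ac)
  have "((\<lambda>t. (norm (f 0))\<^sup>2 + 2 * Re (cnj (f 0) * (z t * g (z t))) + R\<^sup>2 * (norm (g (z t)))\<^sup>2)
     has_integral ((norm (f 0))\<^sup>2 * (2 * pi) + 2 * 0 + R\<^sup>2 * ?I)) {0..2 * pi}"
    by (intro has_integral_add has_integral_mult_right cross I const)
  hence eq: "integral {0..2 * pi} (\<lambda>t. (norm (f (z t)))\<^sup>2) = (norm (f 0))\<^sup>2 * (2 * pi) + R\<^sup>2 * ?I"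
    unfolding split by (simp add: integral_unique)
  define S where "S = (\<Sum>j<N. (norm (fps_nth (fps_expansion g 0) j))\<^sup>2 * R ^ (2 * j))"
  have pow: "R ^ (2 * Suc j) = R\<^sup>2 * R ^ (2 * j)" for j
    using power_add[of R 2 "2 * j"] by simp
  have sum: "(\<Sum>j<Suc N. (norm (fps_nth (fps_expansion f 0) j))\<^sup>2 * R ^ (2 * j)) = (norm (f 0))\<^sup>2 + R\<^sup>2 * S"
    unfolding sum.lessThan_Suc_shift f0 g(4) pow S_def sum_distrib_left by (simp add: mult_ac)
  have "R\<^sup>2 * (2 * pi * S) \<le> R\<^sup>2 * ?I"
    using Suc.IH[OF g(1)] unfolding z_def S_def by (intro mult_left_mono) auto
  hence "2 * pi * ((norm (f 0))\<^sup>2 + R\<^sup>2 * S) \<le> (norm (f 0))\<^sup>2 * (2 * pi) + R\<^sup>2 * ?I"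
    by (simp add: algebra_simps)
  thus ?case using eq unfolding sum z_def by (simp only:)
qed

section \<open>Areas of injective holomorphic images\<close>

text \<open>
  The change-of-variables theorem lives on \<open>real^2\<close>, Fubini's theorem for continuous functions on
  \<open>real \<times> real\<close>; the identification of the two spaces preserves boxes and their content.
\<close>

lemma has_integral_vec2_imp_prod:
  fixes f :: "real^2 \<Rightarrow> real" and a b :: "real^2"
  assumes "(f has_integral i) (cbox a b)"
  shows "((\<lambda>(x, y). f (vector [x, y])) has_integral i) (cbox (a$1, a$2) (b$1, b$2))"
proof -
  define g :: "real \<times> real \<Rightarrow> real^2" where "g = (\<lambda>(x, y). vector [x, y])"
  define h :: "real^2 \<Rightarrow> real \<times> real" where "h = (\<lambda>v. (v$1, v$2))"
  have hg: "h (g p) = p" for p by (auto simp: g_def h_def split: prod.split)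
  have gh: "g (h v) = v" for v by (auto simp: g_def h_def vec_eq_iff forall_2)
  have himg: "h ` cbox u v = cbox (u$1, u$2) (v$1, v$2)" for u v
  proof (intro equalityI subsetI)
    fix p assume "p \<in> h ` cbox u v"
    thus "p \<in> cbox (u$1, u$2) (v$1, v$2)"
      by (auto simp: h_def mem_box_cart cbox_Pair_eq)
  next
    fix p assume "p \<in> cbox (u$1, u$2) (v$1, v$2)"
    hence "g p \<in> cbox u v" by (auto simp: g_def mem_box_cart forall_2 cbox_Pair_eq)
    thus "p \<in> h ` cbox u v" by (metis hg imageI)
  qed
  have gimg: "g ` cbox u v = cbox (g u) (g v)" for u v
  proof -
    have "cbox u v = h ` cbox (g u) (g v)"
      unfolding himg by (simp add: g_def split: prod.split)
    thus ?thesis by (simp add: image_image gh)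
  qed
  have cont: "continuous (at p) g" for p
  proof -
    have "linear g" by (rule linearI) (auto simp: g_def vec_eq_iff forall_2)
    thus ?thesis by (simp add: linear_continuous_at linear_conv_bounded_linear)
  qed
  have content: "measure lborel (g ` cbox u v) = 1 * measure lborel (cbox u v)" for u v
  proof -
    obtain u1 u2 v1 v2 where [simp]: "u = (u1, u2)" "v = (v1, v2)"
      by (metis surj_pair)
    show ?thesis
    proof (cases "u1 \<le> v1 \<and> u2 \<le> v2")
      case True
      hence "cbox (g u) (g v) \<noteq> {}"
        by (auto simp: g_def interval_ne_empty_cart forall_2)
      thus ?thesis using True
        unfolding gimg by (subst content_cbox_cart) (auto simp: content_Pair g_def UNIV_2)
    next
      case False
      hence "cbox u v = {}" by (auto simp: cbox_Pair_eq)
      thus ?thesis by simp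
    qed
  qed
  have "((\<lambda>p. f (g p)) has_integral (1 / 1) *\<^sub>R i) (h ` cbox a b)"
    by (rule has_integral_twiddle[OF _ hg gh cont _ _ content assms]) (use gimg himg in auto)
  thus ?thesis by (simp add: himg g_def case_prod_unfold)
qed

text \<open>
  The Jacobian determinant of a holomorphic \<open>u\<close> is \<open>\<bar>u'\<bar>\<^sup>2\<close>, so its integral is the area of the image,
  which lies in a disc of radius \<open>M\<close>.  Injectivity is asked for on the open box only, so that
  a \<open>2 * pi * \<i>\<close>-periodic \<open>u\<close> may be used on a box of height \<open>2 * pi\<close>.
\<close>

lemma area_injective_image_le:
  fixes u :: "complex \<Rightarrow> complex"
  assumes hol: "u holomorphic_on S" and "open S" and sub: "cbox a b \<subseteq> S"
    and inj: "inj_on u (box a b)" and bd: "\<And>w. w \<in> box a b \<Longrightarrow> norm (u w) \<le> M" and "0 \<le> M"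
  shows "(\<lambda>x. integral {Im a..Im b} (\<lambda>y. (norm (deriv u (Complex x y)))\<^sup>2)) integrable_on {Re a..Re b}"
    and "integral {Re a..Re b} (\<lambda>x. integral {Im a..Im b} (\<lambda>y. (norm (deriv u (Complex x y)))\<^sup>2)) \<le> pi * M\<^sup>2"
proof -
  define T :: "complex \<Rightarrow> real^2" where "T = (\<lambda>z. vector [Re z, Im z])"
  define T' :: "real^2 \<Rightarrow> complex" where "T' = (\<lambda>v. Complex (v$1) (v$2))"
  have TT': "T (T' v) = v" for v by (simp add: T_def T'_def vec_eq_iff forall_2)
  have T'T: "T' (T z) = z" for z by (simp add: T_def T'_def)
  have blT: "bounded_linear T"
    by (intro linear_conv_bounded_linear[THEN iffD1] linearI) (auto simp: T_def vec_eq_iff forall_2)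
  have blT': "bounded_linear T'"
    by (intro linear_conv_bounded_linear[THEN iffD1] linearI) (auto simp: T'_def complex_eq_iff)
  have normT: "norm (T z) = norm z" for z
    by (simp add: norm_vec_def T_def L2_set_def UNIV_2 cmod_def)
  have box_iff: "T' v \<in> box a b \<longleftrightarrow> v \<in> box (T a) (T b)" for v
    by (auto simp: T_def T'_def mem_box_cart forall_2 in_box_complex_iff)
  have cbox_iff: "T' v \<in> cbox a b \<longleftrightarrow> v \<in> cbox (T a) (T b)" for v
    by (auto simp: T_def T'_def mem_box_cart forall_2 in_cbox_complex_iff)
  define J where "J v = (norm (deriv u (T' v)))\<^sup>2" for v
  define \<phi> where "\<phi> = T \<circ> u \<circ> T'"
  define D where "D v h = T (deriv u (T' v) * T' h)" for v h
  have box_sub: "box a b \<subseteq> S" using sub box_subset_cbox by blast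
  have der: "(\<phi> has_derivative D v) (at v within box (T a) (T b))" if "v \<in> box (T a) (T b)" for v
  proof -
    have "T' v \<in> S" using that box_iff box_sub by blast
    hence "(u has_derivative (*) (deriv u (T' v))) (at (T' v))"
      using holomorphic_derivI[OF hol \<open>open S\<close>] has_field_derivative_imp_has_derivative by blast
    hence "((\<lambda>x. T (u (T' x))) has_derivative (\<lambda>h. T (deriv u (T' v) * T' h))) (at v)"
      using has_derivative_compose[OF bounded_linear_imp_has_derivative[OF blT'], of u] bounded_linear.has_derivative[OF blT]
      by blast
    thus ?thesis unfolding \<phi>_def D_def o_def by (rule has_derivative_at_withinI)
  qed
  have det: "\<bar>det (matrix (D v))\<bar> = J v" for v
    unfolding J_def cmod_power2
    by (simp add: det_2 matrix_def D_def T_def T'_def axis_def power2_eq_square)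
  have contd: "continuous_on S (deriv u)"
    using holomorphic_deriv[OF hol \<open>open S\<close>] holomorphic_on_imp_continuous_on by blast
  have contJ: "continuous_on (cbox (T a) (T b)) J"
    unfolding J_def
    by (intro continuous_intros continuous_on_compose2[OF contd] linear_continuous_on[OF blT'])
       (use cbox_iff sub in auto)
  define I where "I = integral (cbox (T a) (T b)) J"
  have I: "(J has_integral I) (cbox (T a) (T b))"
    unfolding I_def by (intro integrable_integral integrable_continuous contJ)
  hence "(J has_integral I) (box (T a) (T b))"
    by (simp add: has_integral_open_interval)
  moreover have "inj_on \<phi> (box (T a) (T b))"
    by (rule inj_onI) (metis (no_types, lifting) \<phi>_def box_iff comp_apply inj inj_onD T'T TT')
  ultimately have "\<phi> ` box (T a) (T b) \<in> lmeasurable \<and> measure lebesgue (\<phi> ` box (T a) (T b)) = I"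
    using has_measure_differentiable_image[of "box (T a) (T b)" \<phi> D I] der by (simp add: det)
  moreover have "\<phi> ` box (T a) (T b) \<subseteq> cball 0 M"
    using bd box_iff by (auto simp: \<phi>_def normT)
  ultimately have "I \<le> measure lebesgue (cball (0::real^2) M)"
    by (metis measure_mono_fmeasurable fmeasurableD lmeasurable_cball)
  also have "\<dots> = pi * M\<^sup>2"
    using \<open>0 \<le> M\<close> by (simp add: content_cball unit_ball_vol_2)
  finally have "I \<le> pi * M\<^sup>2" .
  have contp: "continuous_on (cbox (Re a, Im a) (Re b, Im b)) (\<lambda>p. (norm (deriv u (Complex (fst p) (snd p))))\<^sup>2)"
  proof -
    have "continuous_on (cbox (Re a, Im a) (Re b, Im b)) (\<lambda>p. Complex (fst p) (snd p))"
      unfolding Complex_eq by (intro continuous_intros)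
    thus ?thesis
      by (intro continuous_intros continuous_on_compose2[OF contd])
         (use sub in \<open>auto simp: cbox_Pair_eq in_cbox_complex_iff subset_iff\<close>)
  qed
  have Teq: "T z $ 1 = Re z" "T z $ 2 = Im z" for z by (simp_all add: T_def)
  have "((\<lambda>(x, y). J (vector [x, y])) has_integral I) (cbox (Re a, Im a) (Re b, Im b))"
    using has_integral_vec2_imp_prod[OF I] by (simp add: Teq)
  hence "I = integral (cbox (Re a, Im a) (Re b, Im b)) (\<lambda>p. (norm (deriv u (Complex (fst p) (snd p))))\<^sup>2)"
    by (simp add: J_def T'_def case_prod_unfold integral_unique)
  also have "\<dots> = integral (cbox (Re a) (Re b)) (\<lambda>x. integral (cbox (Im a) (Im b))
                     (\<lambda>y. (norm (deriv u (Complex (fst (x, y)) (snd (x, y)))))\<^sup>2))"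
    by (rule integral_prod_continuous[OF contp])
  finally show "integral {Re a..Re b} (\<lambda>x. integral {Im a..Im b} (\<lambda>y. (norm (deriv u (Complex x y)))\<^sup>2)) \<le> pi * M\<^sup>2"
    using \<open>I \<le> pi * M\<^sup>2\<close> by simp
  show "(\<lambda>x. integral {Im a..Im b} (\<lambda>y. (norm (deriv u (Complex x y)))\<^sup>2)) integrable_on {Re a..Re b}"
    using integral_integrable_2dim[OF contp] by simp
qed

section \<open>The area theorem\<close>

text \<open>
  Put \<open>F z = z / P z\<close>.  On the circle \<open>\<bar>z\<bar> = \<rho>\<close> one has \<open>\<bar>F z\<bar> \<ge> 1 / M\<close>, and \<open>F\<close> is open with \<open>F 0 = 0\<close>,
  so \<open>F\<close> maps the disc of radius \<open>\<rho>\<close> onto a set containing the disc of radius \<open>1 / M\<close>.  By injectivity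
  the points outside the former disc cannot be sent into the latter.
\<close>

lemma injective_quotient_confined:
  fixes P :: "complex \<Rightarrow> complex"
  assumes hol: "P holomorphic_on ball 0 1" and nz: "\<And>z. z \<in> ball 0 1 \<Longrightarrow> P z \<noteq> 0"
    and inj: "inj_on (\<lambda>z. z / P z) (ball 0 1)"
    and \<rho>: "0 < \<rho>" "\<rho> < 1" and M: "\<And>z. norm z = \<rho> \<Longrightarrow> norm (P z / z) \<le> M"
    and z: "\<rho> \<le> norm z" "norm z < 1"
  shows "norm (P z / z) \<le> M"
proof -
  define F where "F z = z / P z" for z
  have holF: "F holomorphic_on ball 0 1"
    unfolding F_def using nz by (intro holomorphic_intros hol) auto
  have "norm (P (of_real \<rho>) / of_real \<rho>) > 0" using nz[of "of_real \<rho>"] \<rho> by simp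
  hence M0: "0 < M" by (rule less_le_trans) (use M[of "of_real \<rho>"] \<rho> in simp)
  have sub: "ball 0 \<rho> \<subseteq> ball 0 1" "cball 0 \<rho> \<subseteq> ball (0::complex) 1" using \<rho> by auto
  have "ball (F 0) (1 / M) \<subseteq> F ` ball 0 \<rho>"
  proof (rule ball_subset_open_map_image)
    show "continuous_on (closure (ball 0 \<rho>)) F"
      using holF \<rho> sub by (auto intro: holomorphic_on_imp_continuous_on holomorphic_on_subset)
    have "open (F ` ball 0 \<rho>)"
      by (rule open_mapping_thm3)
         (use holF sub inj in \<open>auto simp: F_def[abs_def] intro: holomorphic_on_subset inj_on_subset\<close>)
    thus "open (F ` interior (ball 0 \<rho>))" by simp
    fix w :: complex assume "w \<in> frontier (ball 0 \<rho>)"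
    hence w: "norm w = \<rho>" using \<rho> by (simp add: frontier_ball)
    have "P w \<noteq> 0" using w \<rho> nz[of w] by simp
    thus "1 / M \<le> norm (F w - F 0)"
      using M[OF w] M0 \<rho> w by (simp add: F_def norm_divide field_simps)
  qed (use \<rho> M0 in auto)
  moreover have "F z \<notin> F ` ball 0 \<rho>"
    using inj z sub by (force simp: F_def[abs_def] inj_on_def)
  ultimately have "1 / M \<le> norm (F z)" by (force simp: F_def)
  moreover have "P z \<noteq> 0" "z \<noteq> 0" using nz[of z] z \<rho> by auto
  ultimately show ?thesis using M0 by (simp add: F_def norm_divide field_simps)
qed

text \<open>
  This is what makes the comparison with a round disc lossless in the limit: \<open>P z / z\<close> maps
  the circle \<open>\<bar>z\<bar> = \<rho>\<close> into the disc of radius \<open>1 / \<rho> + K * \<rho>\<^sup>2\<close>, whose area exceeds \<open>pi / \<rho>\<^sup>2\<close> by only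
  \<open>O(\<rho>)\<close>.  With a term in \<open>z\<^sup>2\<close> in \<open>P\<close> the image would be close to an ellipse, and the excess would
  stay away from \<open>0\<close>.
\<close>

lemma holomorphic_cubic_tangency:
  assumes hol: "P holomorphic_on ball 0 1" and P0: "P 0 = 1"
    and P1: "fps_nth (fps_expansion P 0) 1 = 0" and P2: "fps_nth (fps_expansion P 0) 2 = 0"
  obtains K where "0 \<le> K" and "\<And>z. norm z \<le> 1/2 \<Longrightarrow> norm (P z) \<le> 1 + K * norm z ^ 3"
proof -
  obtain g1 where g1: "g1 holomorphic_on ball 0 1" "\<And>z. P z - P 0 = z * g1 z" "g1 0 = deriv P 0"
    "\<And>n. fps_nth (fps_expansion P 0) (Suc n) = fps_nth (fps_expansion g1 0) n"
    by (rule fps_expansion_quotient[OF hol zero_less_one]) (rule that)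
  obtain g2 where g2: "g2 holomorphic_on ball 0 1" "\<And>z. g1 z - g1 0 = z * g2 z" "g2 0 = deriv g1 0"
    "\<And>n. fps_nth (fps_expansion g1 0) (Suc n) = fps_nth (fps_expansion g2 0) n"
    by (rule fps_expansion_quotient[OF g1(1) zero_less_one]) (rule that)
  obtain g3 where g3: "g3 holomorphic_on ball 0 1" "\<And>z. g2 z - g2 0 = z * g3 z" "g3 0 = deriv g2 0"
    "\<And>n. fps_nth (fps_expansion g2 0) (Suc n) = fps_nth (fps_expansion g3 0) n"
    by (rule fps_expansion_quotient[OF g2(1) zero_less_one]) (rule that)
  have "g1 0 = 0" using P1 g1(4)[of 0] by (simp add: fps_expansion_def)
  moreover have "g2 0 = 0" using P2 g1(4)[of 1] g2(4)[of 0] by (simp add: fps_expansion_def numeral_eq_Suc)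
  ultimately have P: "P z = 1 + z ^ 3 * g3 z" for z
    using g1(2)[of z] g2(2)[of z] g3(2)[of z] P0 by (simp add: power3_eq_cube algebra_simps)
  have "compact (g3 ` cball 0 (1/2))"
    by (intro compact_continuous_image holomorphic_on_imp_continuous_on holomorphic_on_subset[OF g3(1)]) auto
  then obtain K where K: "\<And>z. z \<in> cball 0 (1/2) \<Longrightarrow> norm (g3 z) \<le> K"
    using compact_imp_bounded bounded_iff by (metis (no_types, lifting) image_eqI)
  show thesis
  proof (rule that)
    show "0 \<le> K" using K[of 0] by (simp add: order_trans[OF norm_ge_zero])
    fix z :: complex assume "norm z \<le> 1/2"
    hence "norm z ^ 3 * norm (g3 z) \<le> norm z ^ 3 * K" by (intro mult_left_mono K) auto
    thus "norm (P z) \<le> 1 + K * norm z ^ 3"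
      unfolding P using norm_triangle_ineq[of 1 "z ^ 3 * g3 z"]
      by (simp add: norm_mult norm_power mult.commute)
  qed
qed

text \<open>
  The area of the image of \<open>\<rho> < \<bar>z\<bar> < r\<close> under \<open>g z = P z / z\<close>, computed in logarithmic coordinates:
  with \<open>z = exp (x + \<i> y)\<close> the annulus becomes a rectangle and the derivative of \<open>g (exp w)\<close> is
  \<open>z * g' z = (z * P' z - P z) / z\<close>, whose Laurent coefficients are \<open>j - 1\<close> times those of \<open>P\<close>.  The factor
  \<open>j - 1\<close> in \<open>E\<close> is one of these two factors \<open>j - 1\<close>; the other cancels when \<open>exp ((2 * j - 2) * x)\<close> is
  integrated over \<open>x\<close>.
\<close>

lemma area_annulus:
  fixes P :: "complex \<Rightarrow> complex" and N :: nat
  assumes hol: "P holomorphic_on ball 0 1"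
    and inj: "inj_on (\<lambda>z. P z / z) (ball 0 1 - {0})"
    and \<rho>: "0 < \<rho>" "\<rho> \<le> r" "r < 1"
    and M: "\<And>z. \<rho> \<le> norm z \<Longrightarrow> norm z < 1 \<Longrightarrow> norm (P z / z) \<le> M" and "0 \<le> M"
  defines "E \<equiv> (\<lambda>x::real. \<Sum>j<N. (real j - 1) * (norm (fps_nth (fps_expansion P 0) j))\<^sup>2 * x ^ (2 * j))"
  shows "E r / r\<^sup>2 - E \<rho> / \<rho>\<^sup>2 \<le> M\<^sup>2"
proof -
  define u where "u w = P (exp w) / exp w" for w
  define S where "S = {w::complex. Re w < 0}"
  define a where "a = Complex (ln \<rho>) 0"
  define b where "b = Complex (ln r) (2 * pi)"
  have r: "0 < r" "ln r < 0" "ln \<rho> \<le> ln r" using \<rho> by auto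
  have S: "open S" unfolding S_def by (rule open_halfspace_Re_lt)
  have expS: "exp w \<in> ball 0 1 - {0}" if "w \<in> S" for w using that by (simp add: S_def)
  have holu: "u holomorphic_on S"
    unfolding u_def using expS
    by (intro holomorphic_intros holomorphic_on_compose_gen[OF _ hol, unfolded o_def]) auto
  have cS: "cbox a b \<subseteq> S" using r(2) by (auto simp: S_def a_def b_def in_cbox_complex_iff intro: le_less_trans)
  have bS: "box a b \<subseteq> S" using cS box_subset_cbox by blast
  have inju: "inj_on u (box a b)"
  proof (rule inj_onI)
    fix x y assume xy: "x \<in> box a b" "y \<in> box a b" "u x = u y"
    hence "exp x = exp y"
      using inj_onD[OF inj, of "exp x" "exp y"] expS bS unfolding u_def by blast
    moreover have "\<bar>Im x - Im y\<bar> < 2 * pi" using xy by (auto simp: a_def b_def in_box_complex_iff)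
    ultimately show "x = y" using exp_complex_eqI by blast
  qed
  have bdu: "norm (u w) \<le> M" if "w \<in> box a b" for w
  proof -
    have "ln \<rho> < Re w" using that by (auto simp: a_def in_box_complex_iff)
    hence "exp (ln \<rho>) \<le> exp (Re w)" by simp
    hence "\<rho> \<le> norm (exp w)" using \<rho> by simp
    thus ?thesis unfolding u_def using expS[of w] bS that by (intro M) auto
  qed
  define Q where "Q z = z * deriv P z - P z" for z
  have holQ: "Q holomorphic_on ball 0 1"
    unfolding Q_def by (intro holomorphic_intros holomorphic_deriv hol) auto
  have deru: "deriv u w = Q (exp w) / exp w" if "w \<in> S" for w
  proof -
    have "(P has_field_derivative deriv P (exp w)) (at (exp w))"
      using expS[OF that] by (intro holomorphic_derivI[OF hol]) auto
    hence "((\<lambda>w. P (exp w)) has_field_derivative deriv P (exp w) * exp w) (at w)"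
      by (rule DERIV_chain2) (auto intro!: derivative_eq_intros)
    hence "(u has_field_derivative (deriv P (exp w) * exp w * exp w - P (exp w) * exp w) / (exp w * exp w)) (at w)"
      unfolding u_def by (rule DERIV_divide) (auto intro!: derivative_eq_intros)
    thus ?thesis unfolding Q_def by (subst DERIV_imp_deriv) (auto simp: field_simps)
  qed
  define p where "p j = fps_nth (fps_expansion P 0) j" for j
  have Qj: "fps_nth (fps_expansion Q 0) j = (of_nat j - 1) * p j" for j
  proof -
    have P: "P has_fps_expansion fps_expansion P 0"
      by (rule has_fps_expansion_fps_expansion[OF _ _ hol]) auto
    hence "Q has_fps_expansion fps_X * fps_deriv (fps_expansion P 0) - fps_expansion P 0"
      unfolding Q_def by (intro fps_expansion_intros)
    hence eq: "fps_expansion Q 0 = fps_X * fps_deriv (fps_expansion P 0) - fps_expansion P 0"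
      by (rule fps_expansion_eqI)
    show ?thesis unfolding eq p_def by (cases j) (auto simp: algebra_simps)
  qed
  \<comment> \<open>\<open>L\<close> is a lower bound for the inner integral and \<open>A\<close> its antiderivative.  For \<open>j = 1\<close> the exponent
    vanishes, but so do both coefficients.\<close>
  define w where "w j = (real j - 1)\<^sup>2 * (norm (p j))\<^sup>2" for j
  have wj: "(norm (fps_nth (fps_expansion Q 0) j))\<^sup>2 = w j" for j
  proof -
    have "norm (of_nat j - 1 :: complex) = \<bar>real j - 1\<bar>"
      by (metis norm_of_real of_real_1 of_real_diff of_real_of_nat_eq)
    thus ?thesis by (simp add: Qj w_def norm_mult power_mult_distrib)
  qed
  define I where "I x = integral {0..2 * pi} (\<lambda>y. (norm (deriv u (Complex x y)))\<^sup>2)" for x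
  define L where "L x = (\<Sum>j<N. 2 * pi * w j * exp ((2 * real j - 2) * x))" for x
  have low: "L x \<le> I x" if x: "x \<in> {ln \<rho>..ln r}" for x
  proof -
    have x0: "x < 0" using x r(2) by auto
    have xS: "Complex x y \<in> S" for y using x0 by (simp add: S_def)
    have ex: "exp (Complex x y) = of_real (exp x) * cis y" for y
      by (simp add: exp_eq_polar)
    have "I x = integral {0..2 * pi} (\<lambda>y. (norm (Q (of_real (exp x) * cis y)))\<^sup>2 * exp (- 2 * x))"
      unfolding I_def
      by (intro integral_cong)
         (simp add: deru[OF xS] ex norm_divide norm_mult power_divide exp_minus exp_double divide_inverse
           norm_inverse power_mult_distrib power_inverse)
    also have "\<dots> = integral {0..2 * pi} (\<lambda>y. (norm (Q (of_real (exp x) * cis y)))\<^sup>2) * exp (- 2 * x)"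
      by simp
    finally have I: "I x = integral {0..2 * pi} (\<lambda>y. (norm (Q (of_real (exp x) * cis y)))\<^sup>2) * exp (- 2 * x)" .
    have "2 * pi * (\<Sum>j<N. (norm (fps_nth (fps_expansion Q 0) j))\<^sup>2 * exp x ^ (2 * j)) 
            \<le> integral {0..2 * pi} (\<lambda>y. (norm (Q (of_real (exp x) * cis y)))\<^sup>2)"
      by (rule gutzmer_inequality[OF holQ]) (use x0 in auto)
    hence "2 * pi * (\<Sum>j<N. w j * exp x ^ (2 * j)) * exp (- 2 * x) \<le> I x"
      unfolding wj I by (rule mult_right_mono) simp
    also have "2 * pi * (\<Sum>j<N. w j * exp x ^ (2 * j)) * exp (- 2 * x) = L x"
      unfolding L_def sum_distrib_left sum_distrib_right
      by (intro sum.cong) (simp_all add: exp_of_nat_mult[symmetric] exp_add[symmetric] algebra_simps)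
    finally show ?thesis .
  qed
  define A where "A x = (\<Sum>j<N. pi * ((real j - 1) * (norm (p j))\<^sup>2) * exp ((2 * real j - 2) * x))" for x
  have "(L has_integral A (ln r) - A (ln \<rho>)) {ln \<rho>..ln r}"
  proof (rule fundamental_theorem_of_calculus[OF r(3)])
    fix x
    have "(A has_field_derivative L x) (at x within {ln \<rho>..ln r})"
      unfolding A_def L_def w_def
      by (rule DERIV_sum) (auto intro!: derivative_eq_intros simp: power2_eq_square algebra_simps)
    thus "(A has_vector_derivative L x) (at x within {ln \<rho>..ln r})"
      by (simp add: has_real_derivative_iff_has_vector_derivative)
  qed
  note L = this
  note area = area_injective_image_le[OF holu S cS inju bdu \<open>0 \<le> M\<close>]
  have "A (ln r) - A (ln \<rho>) \<le> integral {ln \<rho>..ln r} I"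
    using L area(1) low unfolding I_def a_def b_def
    by (intro has_integral_le[OF L integrable_integral]) (auto simp: I_def)
  also have "\<dots> \<le> pi * M\<^sup>2"
    using area(2) unfolding I_def a_def b_def by simp
  finally have "A (ln r) - A (ln \<rho>) \<le> pi * M\<^sup>2" .
  moreover have "A (ln x) = pi * (E x / x\<^sup>2)" if "0 < x" for x
  proof -
    have "exp ((2 * real j - 2) * ln x) = x ^ (2 * j) / x\<^sup>2" for j
    proof -
      have "exp ((2 * real j - 2) * ln x) = exp (of_nat (2 * j) * ln x) / exp (of_nat 2 * ln x)"
        by (simp add: exp_diff[symmetric] algebra_simps)
      thus ?thesis using that by (simp only: exp_of_nat_mult exp_ln)
    qed
    thus ?thesis unfolding A_def E_def p_def
      by (simp add: sum_distrib_left sum_divide_distrib mult_ac)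
  qed
  ultimately have "pi * (E r / r\<^sup>2 - E \<rho> / \<rho>\<^sup>2) \<le> pi * M\<^sup>2"
    using r \<rho> by (simp add: right_diff_distrib)
  thus ?thesis by simp
qed

text \<open>
  Gronwall's area theorem for \<open>g z = P z / z = 1 / z + \<Sum> b\<^sub>n z\<^sup>n\<close> with \<open>b\<^sub>0 = b\<^sub>1 = 0\<close>, where \<open>b\<^sub>n\<close> is the
  Taylor coefficient of \<open>P\<close> of index \<open>n + 1\<close>; in the sum below \<open>n = j + 1\<close>.  The divergent term \<open>1 / \<rho>\<^sup>2\<close> of the
  area of the image of the annulus cancels against the area of the confining disc; then \<open>\<rho>\<close> tends to \<open>0\<close>
  and \<open>r\<close> to \<open>1\<close>.
\<close>

theorem area_theorem:
  fixes P :: "complex \<Rightarrow> complex"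
  assumes hol: "P holomorphic_on ball 0 1" and nz: "\<And>z. z \<in> ball 0 1 \<Longrightarrow> P z \<noteq> 0"
    and inj: "inj_on (\<lambda>z. z / P z) (ball 0 1)" and P0: "P 0 = 1"
    and P1: "fps_nth (fps_expansion P 0) 1 = 0" and P2: "fps_nth (fps_expansion P 0) 2 = 0"
  shows "(\<Sum>j<N. real (j + 1) * (norm (fps_nth (fps_expansion P 0) (j + 2)))\<^sup>2) \<le> 1"
proof -
  define v where "v j = real (j + 1) * (norm (fps_nth (fps_expansion P 0) (j + 2)))\<^sup>2" for j
  have v: "0 \<le> v j" for j by (simp add: v_def)
  define R where "R x = (\<Sum>j<N. v j * x ^ (2 * j + 4))" for x :: real
  obtain K where K: "0 \<le> K" "\<And>z. norm z \<le> 1/2 \<Longrightarrow> norm (P z) \<le> 1 + K * norm z ^ 3"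
    by (rule holomorphic_cubic_tangency[OF hol P0 P1 P2]) (rule that)
  \<comment> \<open>The summand for \<open>j = 0\<close> is \<open>-1\<close> and stems from the pole; that for \<open>j = 1\<close> is \<open>0\<close>.\<close>
  have E: "(\<Sum>j<Suc (Suc N). (real j - 1) * (norm (fps_nth (fps_expansion P 0) j))\<^sup>2 * x ^ (2 * j)) = R x - 1" for x :: real
    unfolding sum.lessThan_Suc_shift
    using P0 P1 by (simp add: R_def v_def fps_expansion_def numeral_eq_Suc)
  have inj': "inj_on (\<lambda>z. P z / z) (ball 0 1 - {0})"
  proof (rule inj_onI)
    fix x y assume xy: "x \<in> ball 0 1 - {0}" "y \<in> ball 0 1 - {0}" "P x / x = P y / y"
    hence "x / P x = y / P y" by (metis inverse_divide)
    thus "x = y" using inj_onD[OF inj, of x y] xy by auto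
  qed
  have Rr: "R r \<le> 1" if r: "0 < r" "r < 1" for r
  proof -
    have main: "(R r - 1) / r\<^sup>2 \<le> R 1 * \<rho>\<^sup>2 + 2 * K * \<rho> + K\<^sup>2 * \<rho> ^ 4" if \<rho>: "0 < \<rho>" "\<rho> < r" "\<rho> < 1/2" for \<rho>
    proof -
      define M where "M = (1 + K * \<rho> ^ 3) / \<rho>"
      have M0: "0 \<le> M" using \<rho> K by (simp add: M_def)
      have sph: "norm (P z / z) \<le> M" if "norm z = \<rho>" for z
        using K(2)[of z] that \<rho> by (simp add: M_def norm_divide divide_right_mono)
      have "norm (P z / z) \<le> M" if "\<rho> \<le> norm z" "norm z < 1" for z
        by (rule injective_quotient_confined[OF hol nz inj _ _ sph that]) (use \<rho> r in auto)
      note area_annulus[OF hol inj' \<rho>(1) less_imp_le[OF \<rho>(2)] r(2) this M0, where N = "Suc (Suc N)"]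
      hence "(R r - 1) / r\<^sup>2 - (R \<rho> - 1) / \<rho>\<^sup>2 \<le> M\<^sup>2"
        unfolding E .
      hence "(R r - 1) / r\<^sup>2 \<le> R \<rho> / \<rho>\<^sup>2 + (M\<^sup>2 - 1 / \<rho>\<^sup>2)" by (simp add: diff_divide_distrib)
      also have "M\<^sup>2 - 1 / \<rho>\<^sup>2 = 2 * K * \<rho> + K\<^sup>2 * \<rho> ^ 4"
        using \<rho> by (simp add: M_def power2_eq_square field_simps power3_eq_cube power4_eq_xxxx)
      also have "R \<rho> / \<rho>\<^sup>2 \<le> R 1 * \<rho>\<^sup>2"
      proof -
        have "R \<rho> \<le> R 1 * \<rho> ^ 4"
          unfolding R_def sum_distrib_right
        proof (rule sum_mono)
          fix j
          have "\<rho> ^ (2 * j + 4) \<le> 1 * \<rho> ^ 4"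
            unfolding power_add using \<rho> by (intro mult_right_mono power_le_one) auto
          thus "v j * \<rho> ^ (2 * j + 4) \<le> v j * 1 ^ (2 * j + 4) * \<rho> ^ 4"
            using mult_left_mono[OF _ v[of j]] by simp
        qed
        thus ?thesis using \<rho> by (simp add: field_simps power2_eq_square power4_eq_xxxx)
      qed
      finally show ?thesis by simp
    qed
    have "((\<lambda>\<rho>. R 1 * \<rho>\<^sup>2 + 2 * K * \<rho> + K\<^sup>2 * \<rho> ^ 4) \<longlongrightarrow> R 1 * 0\<^sup>2 + 2 * K * 0 + K\<^sup>2 * 0 ^ 4) (at_right 0)"
      by (intro tendsto_intros)
    moreover have "eventually (\<lambda>\<rho>. (R r - 1) / r\<^sup>2 \<le> R 1 * \<rho>\<^sup>2 + 2 * K * \<rho> + K\<^sup>2 * \<rho> ^ 4) (at_right 0)"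
      using eventually_at_right_real[of 0 "min r (1/2)"] r
      by (auto elim!: eventually_mono intro: main)
    ultimately have "(R r - 1) / r\<^sup>2 \<le> R 1 * 0\<^sup>2 + 2 * K * 0 + K\<^sup>2 * 0 ^ 4"
      by (intro tendsto_lowerbound) auto
    thus ?thesis using r by (simp add: field_simps)
  qed
  have "(R \<longlongrightarrow> R 1) (at_left 1)"
    unfolding R_def by (intro tendsto_intros)
  moreover have "eventually (\<lambda>r. R r \<le> 1) (at_left 1)"
    using eventually_at_left_real[of 0 "1::real"] by (auto elim!: eventually_mono intro: Rr)
  ultimately have "R 1 \<le> 1" by (rule tendsto_upperbound) auto
  thus ?thesis by (simp add: R_def v_def)
qed

section \<open>Root transforms of univalent functions\<close>

text \<open>
  Since \<open>f\<close> vanishes only at \<open>0\<close>, the quotient \<open>f z / z\<close> has a holomorphic logarithm, and \<open>p\<close> is its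
  power with exponent \<open>- 1 / n\<close>.  The function \<open>z / p (z ^ n)\<close> is an \<open>n\<close>-th root of \<open>f (z ^ n)\<close>; equal
  values force equal \<open>z ^ n\<close>, hence equal denominators, hence equal \<open>z\<close>.
\<close>

lemma root_transform:
  assumes f: "f \<in> class_S" and n: "0 < n"
  obtains p where "p holomorphic_on ball 0 1" "\<And>z. z \<in> ball 0 1 \<Longrightarrow> p z \<noteq> 0" "p 0 = 1"
    "\<And>z. z \<in> ball 0 1 \<Longrightarrow> p z ^ n * f z = z" "inj_on (\<lambda>z. z / p (z ^ n)) (ball 0 1)"
proof -
  have hol: "f holomorphic_on ball 0 1" and f0: "f 0 = 0" and f1: "deriv f 0 = 1" and inj: "inj_on f (ball 0 1)"
    using f by (auto simp: class_S_def class_A_def)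
  obtain q where q: "q holomorphic_on ball 0 1" "\<And>z. f z - f 0 = z * q z" "q 0 = deriv f 0"
    "\<And>n. fps_nth (fps_expansion f 0) (Suc n) = fps_nth (fps_expansion q 0) n"
    by (rule fps_expansion_quotient[OF hol zero_less_one]) (rule that)
  have fq: "f z = z * q z" for z using q(2)[of z] f0 by simp
  have qnz: "q z \<noteq> 0" if "z \<in> ball 0 1" for z
  proof (cases "z = 0")
    case True thus ?thesis using q(3) f1 by simp
  next
    case False
    hence "f z \<noteq> f 0" using inj_onD[OF inj, of z 0] that by auto
    thus ?thesis using fq[of z] f0 by auto
  qed
  obtain L where L: "L holomorphic_on ball 0 1" "\<And>z. z \<in> ball 0 1 \<Longrightarrow> exp (L z) = q z"
    by (rule holomorphic_logarithm_exists[OF convex_ball open_ball q(1) qnz, of 0]) (use that in auto)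
  define p where "p z = exp ((L 0 - L z) / of_nat n)" for z
  have pn: "p z ^ n * f z = z" if z: "z \<in> ball 0 1" for z
  proof -
    have "p z ^ n = exp (L 0 - L z)"
      unfolding p_def using n by (simp add: exp_of_nat_mult[symmetric])
    also have "\<dots> = 1 / q z"
      using L(2)[OF z] L(2)[of 0] q(3) f1 by (simp add: exp_diff)
    finally show ?thesis using qnz[OF z] by (simp add: fq)
  qed
  have "inj_on (\<lambda>z. z / p (z ^ n)) (ball 0 1)"
  proof (rule inj_onI)
    fix x y :: complex assume x: "x \<in> ball 0 1" and y: "y \<in> ball 0 1" and eq: "x / p (x ^ n) = y / p (y ^ n)"
    have pw: "z ^ n \<in> ball 0 1" if "z \<in> ball 0 1" for z :: complex
      using that n by (simp add: norm_power power_less_one_iff)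
    have "(z / p (z ^ n)) ^ n = f (z ^ n)" if "z \<in> ball 0 1" for z
      using pn[OF pw[OF that]] by (simp add: power_divide p_def field_simps)
    hence "f (x ^ n) = f (y ^ n)" using x y eq by metis
    hence "x ^ n = y ^ n" using inj_onD[OF inj] pw x y by blast
    thus "x = y" using eq by (simp add: p_def)
  qed
  moreover have "p holomorphic_on ball 0 1" unfolding p_def by (intro holomorphic_intros L) (use n in auto)
  ultimately show thesis using pn by (intro that[of p]) (auto simp: p_def)
qed

section \<open>The Hankel determinant in terms of the cube root\<close>

text \<open>
  The Taylor coefficients of \<open>F = X / A ^ 3\<close>, found one at a time from the convolution
  \<open>A ^ 3 * F = X\<close>.
\<close>

lemma coeffs_X_over_cube:
  fixes A F :: "complex fps"
  assumes eq: "A ^ 3 * F = fps_X" and A0: "fps_nth A 0 = 1"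
  defines "a \<equiv> fps_nth A 1" and "b \<equiv> fps_nth A 2" and "c \<equiv> fps_nth A 3" and "d \<equiv> fps_nth A 4"
  shows "fps_nth F 2 = -3 * a"
    and "fps_nth F 3 = 6 * a\<^sup>2 - 3 * b"
    and "fps_nth F 4 = 12 * a * b - 10 * a ^ 3 - 3 * c"
    and "fps_nth F 5 = 15 * a ^ 4 - 30 * a\<^sup>2 * b + 12 * a * c + 6 * b\<^sup>2 - 3 * d"
proof -
  define B where "B = A ^ 3"
  have B: "fps_nth B 0 = 1" "fps_nth B 1 = 3 * a" "fps_nth B 2 = 3 * b + 3 * a\<^sup>2"
      "fps_nth B 3 = 3 * c + 6 * a * b + a ^ 3"
      "fps_nth B 4 = 3 * d + 6 * a * c + 3 * b\<^sup>2 + 3 * a\<^sup>2 * b"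
    unfolding B_def power3_eq_cube
    by (simp_all add: fps_mult_nth numeral_eq_Suc A0 a_def b_def c_def d_def algebra_simps power2_eq_square)
  have N: "fps_nth (B * F) n = fps_nth fps_X n" for n using eq by (simp add: B_def)
  have F0: "fps_nth F 0 = 0" using N[of 0] by (simp add: fps_mult_nth B)
  have F1: "fps_nth F 1 = 1" using N[of 1] by (simp add: fps_mult_nth B F0)
  have E2: "fps_nth B 1 * fps_nth F 1 + fps_nth F 2 = 0"
    using N[of 2] by (simp add: fps_mult_nth B(1) F0 numeral_eq_Suc add.commute)
  show 2: "fps_nth F 2 = -3 * a" using E2 unfolding B F1 by algebra
  have E3: "fps_nth B 2 * fps_nth F 1 + fps_nth B 1 * fps_nth F 2 + fps_nth F 3 = 0"
    using N[of 3] B(1) F0 by (simp add: fps_mult_nth numeral_eq_Suc algebra_simps)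
  show 3: "fps_nth F 3 = 6 * a\<^sup>2 - 3 * b" using E3 unfolding B F1 2 by algebra
  have E4: "fps_nth B 3 * fps_nth F 1 + fps_nth B 2 * fps_nth F 2 + fps_nth B 1 * fps_nth F 3 + fps_nth F 4 = 0"
    using N[of 4] B(1) F0 by (simp add: fps_mult_nth numeral_eq_Suc algebra_simps)
  show 4: "fps_nth F 4 = 12 * a * b - 10 * a ^ 3 - 3 * c" using E4 unfolding B F1 2 3 by algebra
  have E5: "fps_nth B 4 * fps_nth F 1 + fps_nth B 3 * fps_nth F 2 + fps_nth B 2 * fps_nth F 3
     + fps_nth B 1 * fps_nth F 4 + fps_nth F 5 = 0"
    using N[of 5] B(1) F0 by (simp add: fps_mult_nth numeral_eq_Suc algebra_simps)
  show "fps_nth F 5 = 15 * a ^ 4 - 30 * a\<^sup>2 * b + 12 * a * c + 6 * b\<^sup>2 - 3 * d"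
    using E5 unfolding B F1 2 3 4 by algebra
qed

lemma hankel_in_root_coeffs:
  fixes a b c d :: complex
  shows "(6 * a\<^sup>2 - 3 * b) * (15 * a ^ 4 - 30 * a\<^sup>2 * b + 12 * a * c + 6 * b\<^sup>2 - 3 * d) - (12 * a * b - 10 * a ^ 3 - 3 * c)\<^sup>2
   = 9 * b * d + 36 * a * b * c - 18 * b ^ 3 - 18 * a\<^sup>2 * b\<^sup>2 + 15 * a ^ 4 * b - 18 * a\<^sup>2 * d + 12 * a ^ 3 * c - 10 * a ^ 6 - 9 * c\<^sup>2"
  by algebra

lemma am_gm_weighted:
  fixes x y p q :: real
  assumes "0 < p" and "p * q = 1"
  shows "2 * (x * y) \<le> p * x\<^sup>2 + q * y\<^sup>2"
proof -
  have q: "q = 1 / p" using assms by (simp add: field_simps)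
  have "0 \<le> (p * x - y)\<^sup>2 / p" using assms by simp
  also have "\<dots> = p * x\<^sup>2 + q * y\<^sup>2 - 2 * (x * y)"
    using assms unfolding q by (simp add: power2_eq_square field_simps)
  finally show ?thesis by simp
qed

lemma hankel_majorant_le_lacunary:
  fixes b c d :: real
  assumes "0 \<le> b" "0 \<le> c" "0 \<le> d" and w: "5 * b\<^sup>2 + 8 * c\<^sup>2 + 11 * d\<^sup>2 \<le> 1"
  shows "9 * b * d + 18 * b ^ 3 + 9 * c\<^sup>2 \<le> 2.02757"
proof -
  have b2: "b\<^sup>2 \<le> 1/5" using w zero_le_power2[of c] zero_le_power2[of d] by linarith
  have "b \<le> 45/100" by (rule power2_le_imp_le) (use b2 in \<open>simp_all add: power2_eq_square\<close>)
  hence "b * b\<^sup>2 \<le> 45/100 * b\<^sup>2" by (intro mult_right_mono) auto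
  hence "18 * b ^ 3 \<le> 81/10 * b\<^sup>2" by (simp add: power3_eq_cube power2_eq_square)
  moreover have "2 * (b * d) \<le> (4/9) * b\<^sup>2 + (9/4) * d\<^sup>2" by (rule am_gm_weighted) simp_all
  ultimately have "9 * (b * d) + 18 * b ^ 3 + 9 * c\<^sup>2 \<le> 202/100"
    using w zero_le_power2[of b] zero_le_power2[of c] zero_le_power2[of d] by linarith
  thus ?thesis by (simp add: mult.assoc)
qed

text \<open>
  The area inequality confines \<open>(a, b, c, d)\<close> to an ellipsoid on which the majorant stays below about
  \<open>2.4\<close>, so crude estimates suffice.  The bounds for \<open>a\<close>, \<open>b\<close> and \<open>a * b\<close> on the ellipsoid
  reduce every term to a quadratic one, except for \<open>a * b * c\<close>, which is bounded by a constant; the resulting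
  quadratic form is then dominated by a multiple of \<open>2 * a\<^sup>2 + 5 * b\<^sup>2 + 8 * c\<^sup>2 + 11 * d\<^sup>2\<close>.
\<close>

lemma hankel_majorant_le:
  fixes a b c d :: real
  assumes nn: "0 \<le> a" "0 \<le> b" "0 \<le> c" "0 \<le> d" and w: "2 * a\<^sup>2 + 5 * b\<^sup>2 + 8 * c\<^sup>2 + 11 * d\<^sup>2 \<le> 1"
  shows "9 * b * d + 36 * a * b * c + 18 * b ^ 3 + 18 * a\<^sup>2 * b\<^sup>2 + 15 * a ^ 4 * b + 18 * a\<^sup>2 * d
           + 12 * a ^ 3 * c + 10 * a ^ 6 + 9 * c\<^sup>2 \<le> 4.8986977"
proof -
  have a2: "a\<^sup>2 \<le> 1/2" and b2: "b\<^sup>2 \<le> 1/5"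
    using w zero_le_power2[of a] zero_le_power2[of b] zero_le_power2[of c] zero_le_power2[of d] by linarith+
  have a: "a \<le> 71/100" by (rule power2_le_imp_le) (use a2 in \<open>simp_all add: power2_eq_square\<close>)
  have b: "b \<le> 45/100" by (rule power2_le_imp_le) (use b2 in \<open>simp_all add: power2_eq_square\<close>)
  \<comment> \<open>The ratio \<open>63 : 100\<close> approximates \<open>sqrt 2 : sqrt 5\<close>, which balances \<open>2 * a\<^sup>2\<close> against \<open>5 * b\<^sup>2\<close>.\<close>
  have "2 * (a * b) \<le> (63/100) * a\<^sup>2 + (100/63) * b\<^sup>2" by (rule am_gm_weighted) simp_all
  hence abc: "a * b \<le> 127/800 - 127/100 * c\<^sup>2"
    using w zero_le_power2[of a] zero_le_power2[of b] zero_le_power2[of d] by linarith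
  hence ab: "a * b \<le> 16/100" using zero_le_power2[of c] by linarith
  have nab: "0 \<le> a * b" using nn by simp
  have 1: "18 * b ^ 3 \<le> 81/10 * b\<^sup>2"
    using mult_right_mono[OF b, of "b\<^sup>2"] by (simp add: power3_eq_cube power2_eq_square)
  have 2: "18 * a\<^sup>2 * b\<^sup>2 \<le> 288/100 * (a * b)"
    using mult_right_mono[OF ab nab] by (simp add: power2_eq_square algebra_simps)
  have "a\<^sup>2 * a \<le> 1/2 * (71/100)" using a2 a nn by (intro mult_mono) auto
  hence a3: "a ^ 3 \<le> 355/1000" by (simp add: power3_eq_cube power2_eq_square algebra_simps)
  have 3: "15 * a ^ 4 * b \<le> 5325/1000 * (a * b)"
    using mult_right_mono[OF a3 nab] by (simp add: power3_eq_cube power4_eq_xxxx algebra_simps)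
  have 4: "18 * a\<^sup>2 * d \<le> 1278/100 * (a * d)"
    using mult_right_mono[OF a, of "a * d"] nn by (simp add: power2_eq_square algebra_simps)
  have 5: "12 * a ^ 3 * c \<le> 6 * (a * c)"
    using mult_right_mono[OF a2, of "a * c"] nn by (simp add: power2_eq_square power3_eq_cube algebra_simps)
  have "a\<^sup>2 * a\<^sup>2 \<le> 1/2 * (1/2)" using a2 by (intro mult_mono) auto
  hence 6: "10 * a ^ 6 \<le> 5/2 * a\<^sup>2"
    using mult_right_mono[of "a\<^sup>2 * a\<^sup>2" "1/4" "a\<^sup>2"] by (simp add: power2_eq_square numeral_eq_Suc algebra_simps)
  have 7: "36 * a * b * c \<le> 779/1000"
  proof -
    \<comment> \<open>\<open>k\<close> approximates the maximiser \<open>1 / sqrt 24\<close> of \<open>c - 8 * c ^ 3\<close>, rounded upwards so that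
      \<open>24 * k\<^sup>2 \<ge> 1\<close>.\<close>
    define k :: real where "k = 49/240"
    have "0 \<le> (c - k)\<^sup>2 * (c + 2 * k)" using nn by (simp add: k_def)
    also have "\<dots> = c ^ 3 - 3 * k\<^sup>2 * c + 2 * k ^ 3"
      by (simp add: power2_eq_square power3_eq_cube algebra_simps)
    also have "\<dots> = c ^ 3 - 2401/19200 * c + 117649/6912000"
      by (simp add: k_def power2_eq_square power3_eq_cube)
    finally have "c - 8 * c ^ 3 \<le> 1362/10000" using nn(3) by linarith
    moreover have "(a * b) * c \<le> (127/800 - 127/100 * c\<^sup>2) * c"
      by (rule mult_right_mono[OF abc nn(3)])
    ultimately have "36 * (a * b * c) \<le> 779/1000" by (simp add: algebra_simps power2_eq_square power3_eq_cube)
    thus ?thesis by (simp add: mult.assoc)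
  qed
  \<comment> \<open>The weights are rounded ratios of the entries of the dominant eigenvector of the quadratic form
    relative to that of the ellipsoid.\<close>
  have 8: "2 * (a * b) \<le> (1/2) * a\<^sup>2 + 2 * b\<^sup>2" "2 * (a * d) \<le> (1/4) * a\<^sup>2 + 4 * d\<^sup>2"
    "2 * (a * c) \<le> (1/4) * a\<^sup>2 + 4 * c\<^sup>2" "2 * (b * d) \<le> (1/2) * b\<^sup>2 + 2 * d\<^sup>2"
    by (rule am_gm_weighted; simp)+
  have 9: "9 * b * d = 9 * (b * d)" by simp
  have "9 * b * d + 36 * a * b * c + 18 * b ^ 3 + 18 * a\<^sup>2 * b\<^sup>2 + 15 * a ^ 4 * b + 18 * a\<^sup>2 * d
           + 12 * a ^ 3 * c + 10 * a ^ 6 + 9 * c\<^sup>2 \<le> 489/100"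
    using 1 2 3 4 5 6 7 8 9 w zero_le_power2[of a] zero_le_power2[of b] zero_le_power2[of c] zero_le_power2[of d]
    by linarith
  thus ?thesis by simp
qed

section \<open>The bounds for the Hankel determinant\<close>

theorem theorem3:
  shows "(\<exists>C1::real. 2.02757 \<le> C1 \<and> C1 < 2.02758 \<and>
            (\<forall>f\<in>class_S. taylor_coeff f 2 = 0 \<longrightarrow> norm (hankel2 3 f) \<le> C1)) \<and>
         (\<exists>C2::real. 4.8986977 \<le> C2 \<and> C2 < 4.8986978 \<and>
            (\<forall>f\<in>class_S. norm (hankel2 3 f) \<le> C2))"
proof -
  have main: "norm (hankel2 3 f) \<le> 4.8986977 \<and> (taylor_coeff f 2 = 0 \<longrightarrow> norm (hankel2 3 f) \<le> 2.02757)"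
    if f: "f \<in> class_S" for f
  proof -
    obtain p where p: "p holomorphic_on ball 0 1" "\<And>z. z \<in> ball 0 1 \<Longrightarrow> p z \<noteq> 0" "p 0 = 1"
      "\<And>z. z \<in> ball 0 1 \<Longrightarrow> p z ^ 3 * f z = z" "inj_on (\<lambda>z. z / p (z ^ 3)) (ball 0 1)"
      by (rule root_transform[OF f, of 3]) (use that in auto)
    define A where "A = fps_expansion p 0"
    define F where "F = fps_expansion f 0"
    have A: "p has_fps_expansion A"
      unfolding A_def by (rule has_fps_expansion_fps_expansion[OF _ _ p(1)]) auto
    have holf: "f holomorphic_on ball 0 1" using f by (simp add: class_S_def class_A_def)
    have F: "f has_fps_expansion F"
      unfolding F_def by (rule has_fps_expansion_fps_expansion[OF _ _ holf]) auto
    have "(\<lambda>z. p z ^ 3 * f z) has_fps_expansion A ^ 3 * F"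
      by (intro fps_expansion_intros A F)
    moreover have ev: "eventually (\<lambda>z. p z ^ 3 * f z = z) (nhds 0)"
      using eventually_nhds_in_open[of "ball 0 1" "0::complex"] by (auto elim!: eventually_mono intro: p(4))
    ultimately have "(\<lambda>z. z) has_fps_expansion A ^ 3 * F"
      by (simp only: has_fps_expansion_cong[OF ev refl])
    hence AF: "A ^ 3 * F = fps_X"
      using fps_expansion_unique_complex has_fps_expansion_fps_X by blast
    have A0: "fps_nth A 0 = 1" by (simp add: A_def fps_expansion_def p(3))
    define a b c d where abcd: "a = fps_nth A 1" "b = fps_nth A 2" "c = fps_nth A 3" "d = fps_nth A 4"
    note co = coeffs_X_over_cube[OF AF A0, folded abcd]
    \<comment> \<open>With \<open>n = 3\<close> the first two coefficients of \<open>p (z ^ n)\<close> after the constant one vanish, as the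
      area theorem asks, while its remaining coefficients are still those of \<open>p\<close>.\<close>
    define P where "P z = p (z ^ 3)" for z
    have pw: "z ^ 3 \<in> ball 0 1" if "z \<in> ball 0 1" for z :: complex
      using that by (simp add: norm_power power_less_one_iff)
    have "(p \<circ> (\<lambda>z. z ^ 3)) has_fps_expansion (A oo fps_X ^ 3)"
      by (intro has_fps_expansion_compose A fps_expansion_intros) simp
    hence "P has_fps_expansion (A oo fps_X ^ 3)" by (simp add: P_def[abs_def] o_def)
    hence PA: "fps_expansion P 0 = A oo fps_X ^ 3" by (rule fps_expansion_eqI)
    have "(\<Sum>j<11. real (j + 1) * (norm (fps_nth (fps_expansion P 0) (j + 2)))\<^sup>2) \<le> 1"
    proof (rule area_theorem)
      show "P holomorphic_on ball 0 1"
        unfolding P_def using pw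
        by (intro holomorphic_on_compose_gen[OF _ p(1), unfolded o_def] holomorphic_intros) auto
    qed (use p pw in \<open>auto simp: P_def[abs_def] PA[unfolded P_def[abs_def]] fps_nth_compose_X_power\<close>)
    \<comment> \<open>The coefficient of \<open>z ^ (3 * k)\<close> enters with weight \<open>3 * k - 1\<close>.\<close>
    hence w: "2 * (norm a)\<^sup>2 + 5 * (norm b)\<^sup>2 + 8 * (norm c)\<^sup>2 + 11 * (norm d)\<^sup>2 \<le> 1"
      by (simp add: PA fps_nth_compose_X_power lessThan_nat_numeral abcd
          numeral_2_eq_2[symmetric] numeral_3_eq_3[symmetric])
    have "hankel2 3 f = fps_nth F 3 * fps_nth F 5 - (fps_nth F 4)\<^sup>2"
      by (simp add: hankel2_def taylor_coeff_def F_def)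
    hence H: "hankel2 3 f = 9 * b * d + 36 * a * b * c - 18 * b ^ 3 - 18 * a\<^sup>2 * b\<^sup>2 + 15 * a ^ 4 * b
        - 18 * a\<^sup>2 * d + 12 * a ^ 3 * c - 10 * a ^ 6 - 9 * c\<^sup>2"
      unfolding co hankel_in_root_coeffs .
    have "norm (hankel2 3 f) \<le> norm (9 * b * d) + norm (36 * a * b * c) + norm (18 * b ^ 3) + norm (18 * a\<^sup>2 * b\<^sup>2)
        + norm (15 * a ^ 4 * b) + norm (18 * a\<^sup>2 * d) + norm (12 * a ^ 3 * c) + norm (10 * a ^ 6) + norm (9 * c\<^sup>2)"
      unfolding H by (intro order_trans[OF norm_triangle_ineq] order_trans[OF norm_triangle_ineq4] add_mono order_refl)
    hence N: "norm (hankel2 3 f) \<le> 9 * norm b * norm d + 36 * norm a * norm b * norm c + 18 * norm b ^ 3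
        + 18 * (norm a)\<^sup>2 * (norm b)\<^sup>2 + 15 * norm a ^ 4 * norm b + 18 * (norm a)\<^sup>2 * norm d
        + 12 * norm a ^ 3 * norm c + 10 * norm a ^ 6 + 9 * (norm c)\<^sup>2"
      by (simp add: norm_mult norm_power)
    moreover have "norm (hankel2 3 f) \<le> 2.02757" if "taylor_coeff f 2 = 0"
    proof -
      have "a = 0" using that co(1) by (simp add: taylor_coeff_def F_def)
      thus ?thesis using N w hankel_majorant_le_lacunary[of "norm b" "norm c" "norm d"] by simp
    qed
    ultimately show ?thesis using hankel_majorant_le[OF _ _ _ _ w] by force
  qed
  show ?thesis
    using main by (intro conjI exI[of _ "2.02757"] exI[of _ "4.8986977"]) auto
qed

end
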